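(* Let $G$ be a finite cyclic group, let $k\in \mathbb N$, and let $S$ be a zero-sum sequence over $G$ of length $\mathsf D_k(G)$. Then $S\in \mathcal M_k(G)$ if and only if there exists $g\in G$ with $\ord(g)=|G|$ such that $S=g^{k|G|}$.
   Context: A sequence over $G$ is a finite unordered sequence of elements of $G$ with repetition allowed, written multiplicatively ($g^m$ is $m$ copies of $g$); it is zero-sum if its terms sum to $0$. $\mathsf D_k(G)$ is the smallest integer $\ell$ such that every sequence over $G$ of length at least $\ell$ has $k$ disjoint nontrivial zero-sum subsequences. $\mathcal M_k(G)$ is the set of zero-sum sequences over $G$ that cannot be partitioned into $k+1$ nontrivial zero-sum subsequences. *)

theory Defs
  imports "HOL-Library.Multiset" "HOL-Algebra.Multiplicative_Group" "HOL-Algebra.Elementary_Groups"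
begin

text \<open>
  Groups are written multiplicatively here, as in HOL-Algebra, so that ``sum'' means product and
  \<open>0\<close> is \<open>\<one>\<close>. Sequences are multisets over the carrier; the trivial sequence is \<open>{#}\<close>.
\<close>

definition seq_over :: "('a, 'b) monoid_scheme \<Rightarrow> 'a multiset \<Rightarrow> bool" where
  "seq_over G S \<longleftrightarrow> set_mset S \<subseteq> carrier G"

definition seq_sum :: "('a, 'b) monoid_scheme \<Rightarrow> 'a multiset \<Rightarrow> 'a" where
  "seq_sum G S = finprod G (\<lambda>g. g [^]\<^bsub>G\<^esub> count S g) (set_mset S)"

definition zero_sum :: "('a, 'b) monoid_scheme \<Rightarrow> 'a multiset \<Rightarrow> bool" where
  "zero_sum G S \<longleftrightarrow> seq_over G S \<and> seq_sum G S = \<one>\<^bsub>G\<^esub>"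

text \<open>
  A family of \<open>k\<close> subsequences is a multiset of multisets (the same subsequence may be repeated).
  Its members are disjoint subsequences of \<open>S\<close> iff their multiset sum is contained in \<open>S\<close>, and
  they partition \<open>S\<close> iff it equals \<open>S\<close>.
\<close>

definition nontrivial_zero_sums ::
    "('a, 'b) monoid_scheme \<Rightarrow> nat \<Rightarrow> 'a multiset multiset \<Rightarrow> bool" where
  "nontrivial_zero_sums G k \<T> \<longleftrightarrow> size \<T> = k \<and> (\<forall>T\<in>#\<T>. T \<noteq> {#} \<and> zero_sum G T)"

definition Davenport :: "('a, 'b) monoid_scheme \<Rightarrow> nat \<Rightarrow> nat" where
  "Davenport G k =
    (LEAST l. \<forall>S. seq_over G S \<and> l \<le> size S \<longrightarrow>
       (\<exists>\<T>. nontrivial_zero_sums G k \<T> \<and> \<Sum>\<^sub># \<T> \<subseteq># S))"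

definition M_set :: "('a, 'b) monoid_scheme \<Rightarrow> nat \<Rightarrow> 'a multiset set" where
  "M_set G k =
    {S. zero_sum G S \<and> \<not> (\<exists>\<T>. nontrivial_zero_sums G (k + 1) \<T> \<and> \<Sum>\<^sub># \<T> = S)}"

lemma seq_sum_empty [simp]: "comm_group G \<Longrightarrow> seq_sum G {#} = \<one>\<^bsub>G\<^esub>"
  by (simp add: seq_sum_def comm_group_def comm_monoid.finprod_empty)

lemma seq_sum_add_mset:
  assumes "comm_group G" "seq_over G S" "g \<in> carrier G"
  shows "seq_sum G (add_mset g S) = g \<otimes>\<^bsub>G\<^esub> seq_sum G S"
proof -
  interpret comm_group G by fact
  have sub: "set_mset S \<subseteq> carrier G" using assms(2) by (simp add: seq_over_def)
  define A where "A = set_mset S - {g}"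
  have A: "finite A" "g \<notin> A" "A \<subseteq> carrier G" using sub by (auto simp: A_def)
  have split: "seq_sum G T = (g [^]\<^bsub>G\<^esub> count T g) \<otimes>\<^bsub>G\<^esub> finprod G (\<lambda>h. h [^]\<^bsub>G\<^esub> count S h) A"
    if T: "set_mset T \<subseteq> insert g A" "A \<subseteq> set_mset T" "\<And>h. h \<in> A \<Longrightarrow> count T h = count S h" for T
  proof -
    have "seq_sum G T = finprod G (\<lambda>h. h [^]\<^bsub>G\<^esub> count T h) (insert g A)"
      unfolding seq_sum_def
      by (rule finprod_mono_neutral_cong_left)
         (use A T assms(3) in \<open>auto simp: not_in_iff\<close>)
    also have "\<dots> = (g [^]\<^bsub>G\<^esub> count T g) \<otimes>\<^bsub>G\<^esub> finprod G (\<lambda>h. h [^]\<^bsub>G\<^esub> count T h) A"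
      by (rule finprod_insert) (use A assms(3) in auto)
    also have "finprod G (\<lambda>h. h [^]\<^bsub>G\<^esub> count T h) A = finprod G (\<lambda>h. h [^]\<^bsub>G\<^esub> count S h) A"
      by (rule finprod_cong') (use A T in auto)
    finally show ?thesis .
  qed
  have P: "finprod G (\<lambda>h. h [^]\<^bsub>G\<^esub> count S h) A \<in> carrier G"
    by (rule finprod_closed) (use A in auto)
  have 1: "seq_sum G (add_mset g S) =
      (g [^]\<^bsub>G\<^esub> Suc (count S g)) \<otimes>\<^bsub>G\<^esub> finprod G (\<lambda>h. h [^]\<^bsub>G\<^esub> count S h) A"
    by (subst split) (auto simp: A_def)
  have 2: "seq_sum G S = (g [^]\<^bsub>G\<^esub> count S g) \<otimes>\<^bsub>G\<^esub> finprod G (\<lambda>h. h [^]\<^bsub>G\<^esub> count S h) A"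
    by (rule split) (auto simp: A_def)
  show ?thesis
    unfolding 1 2 using assms(3) P by (simp add: m_ac)
qed

end

theory Submission
  imports Defs
begin

text \<open>
  Among any \<open>n = |G|\<close> terms, two prefix products coincide, so there is a nontrivial zero-sum
  subsequence of length at most \<open>n\<close>; removing such subsequences greedily gives
  \<open>D\<^sub>k(G) \<le> k n\<close>, and \<open>g\<^bsup>kn-1\<^esup>\<close> for a generator \<open>g\<close> shows equality. If \<open>S\<close> has length \<open>k n\<close> and
  contains a nontrivial zero-sum subsequence shorter than \<open>n\<close>, the greedy removal started there
  leaves a nonempty rest after \<open>k\<close> steps, hence \<open>k + 1\<close> parts. So for \<open>S\<close> in \<open>M\<^sub>k(G)\<close> no such short
  subsequence exists, and the \<open>n\<close> prefix products of length less than \<open>n\<close> of any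
  \<open>n\<close> terms \<open>g, h, \<dots>\<close> of \<open>S\<close> exhaust \<open>G\<close>. In particular \<open>h\<close> is one of them, which without
  short zero-sum subsequences is only possible for \<open>h = g\<close>.
\<close>

section \<open>Sums of sequences and of their subsequences\<close>

lemma seq_over_union [simp]: "seq_over G (S + T) \<longleftrightarrow> seq_over G S \<and> seq_over G T"
  by (auto simp: seq_over_def)

lemma seq_over_add_mset [simp]: "seq_over G (add_mset g S) \<longleftrightarrow> g \<in> carrier G \<and> seq_over G S"
  by (auto simp: seq_over_def)

lemma seq_over_mono: "T \<subseteq># S \<Longrightarrow> seq_over G S \<Longrightarrow> seq_over G T"
  using set_mset_mono by (fastforce simp: seq_over_def)

lemma mset_infix_subset: "mset (drop i (take j xs)) \<subseteq># mset xs"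
proof -
  have "mset (drop i (take j xs)) \<subseteq># mset (take j xs)"
    by (metis append_take_drop_id mset_append mset_subset_eq_add_right)
  also have "\<dots> \<subseteq># mset xs"
    by (metis append_take_drop_id mset_append mset_subset_eq_add_left)
  finally show ?thesis .
qed

context comm_group
begin

lemma seq_sum_closed: "seq_over G S \<Longrightarrow> seq_sum G S \<in> carrier G"
  unfolding seq_over_def seq_sum_def by (rule finprod_closed) auto

lemma seq_sum_union:
  assumes "seq_over G S" "seq_over G T"
  shows "seq_sum G (S + T) = seq_sum G S \<otimes> seq_sum G T"
  using assms
proof (induction S)
  case empty
  then show ?case
    by (simp add: seq_sum_empty[OF comm_group_axioms] seq_sum_closed)
next
  case (add x S)
  then show ?case
    by (simp add: seq_sum_add_mset[OF comm_group_axioms] seq_sum_closed m_assoc)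
qed

lemma seq_sum_replicate:
  "g \<in> carrier G \<Longrightarrow> seq_sum G (replicate_mset m g) = g [^] m"
  \<comment> \<open>The support is empty for \<open>m = 0\<close> and \<open>{g}\<close> otherwise,
    hence the case split.\<close>
  by (cases m) (simp_all add: seq_sum_def seq_sum_empty[OF comm_group_axioms])

lemma zero_sum_cancel_left:
  assumes "zero_sum G S" "zero_sum G (S + T)"
  shows "zero_sum G T"
proof -
  have "seq_over G S" "seq_over G T" "seq_sum G S = \<one>"
    using assms by (auto simp: zero_sum_def)
  with assms(2) show ?thesis
    by (simp add: zero_sum_def seq_sum_union seq_sum_closed)
qed

lemma zero_sum_Sum_mset:
  "(\<And>T. T \<in># \<T> \<Longrightarrow> zero_sum G T) \<Longrightarrow> zero_sum G (\<Sum>\<^sub># \<T>)"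
proof (induction \<T>)
  case empty
  then show ?case by (simp add: zero_sum_def seq_over_def seq_sum_empty[OF comm_group_axioms])
next
  case (add T \<T>)
  then show ?case by (simp add: zero_sum_def seq_sum_union)
qed

text \<open>Cancelling the common prefix product leaves product one for the block of terms between
  positions \<open>i\<close> and \<open>j\<close>.\<close>

lemma zero_sum_infix:
  assumes xs: "set xs \<subseteq> carrier G" and "i \<le> j"
    and eq: "seq_sum G (mset (take i xs)) = seq_sum G (mset (take j xs))"
  shows "zero_sum G (mset (drop i (take j xs)))"
proof -
  have over: "seq_over G (mset (take i xs))" "seq_over G (mset (drop i (take j xs)))"
    using xs by (auto simp: seq_over_def dest!: in_set_takeD in_set_dropD)
  have "take i (take j xs) = take i xs"
    using \<open>i \<le> j\<close> by (simp add: min_def)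
  then have "mset (take j xs) = mset (take i xs) + mset (drop i (take j xs))"
    by (metis append_take_drop_id mset_append)
  then have "seq_sum G (mset (take i xs)) =
      seq_sum G (mset (take i xs)) \<otimes> seq_sum G (mset (drop i (take j xs)))"
    using eq seq_sum_union[OF over] by simp
  then show ?thesis
    using over by (simp add: zero_sum_def seq_sum_closed)
qed

section \<open>Greedy extraction of short zero-sum subsequences\<close>

lemma short_zero_sum_exists:
  assumes fin: "finite (carrier G)" and S: "seq_over G S" and size: "order G \<le> size S"
  obtains T where "T \<subseteq># S" "T \<noteq> {#}" "zero_sum G T" "size T \<le> order G"
proof -
  obtain xs where xs: "mset xs = S" by (metis ex_mset)
  have len: "order G \<le> length xs" using size xs by auto
  have set: "set xs \<subseteq> carrier G" using S xs by (auto simp: seq_over_def)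
  let ?f = "\<lambda>i. seq_sum G (mset (take i xs))"
  have "?f ` {..order G} \<subseteq> carrier G"
    using set by (auto intro!: seq_sum_closed simp: seq_over_def dest!: in_set_takeD)
  then have "card (?f ` {..order G}) \<le> order G"
    unfolding order_def by (rule card_mono[OF fin])
  \<comment> \<open>The prefixes of length 0 to \<open>order G\<close>, the empty one included, are
    one more than the available values.\<close>
  then have "\<not> inj_on ?f {..order G}"
    using card_image[of ?f "{..order G}"] by auto
  then obtain i j where ij: "i < j" "j \<le> order G" "?f i = ?f j"
    unfolding inj_on_def by (metis atMost_iff linorder_neqE_nat)
  show ?thesis
  proof (rule that)
    show "mset (drop i (take j xs)) \<subseteq># S" using mset_infix_subset xs by metis
    show "mset (drop i (take j xs)) \<noteq> {#}" using ij len by simp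
    show "zero_sum G (mset (drop i (take j xs)))" using zero_sum_infix set ij by simp
    show "size (mset (drop i (take j xs))) \<le> order G" using ij len by simp
  qed
qed

text \<open>Induction on \<open>m\<close>, removing one short zero-sum subsequence at a time. The
  bound on the total size is carried along so that a sequence with more than
  \<open>m * order G\<close> terms is known to keep a nonempty rest.\<close>

lemma disjoint_zero_sums_exist:
  assumes fin: "finite (carrier G)"
  shows "seq_over G S \<Longrightarrow> m * order G \<le> size S \<Longrightarrow>
    \<exists>\<T>. nontrivial_zero_sums G m \<T> \<and> \<Sum>\<^sub># \<T> \<subseteq># S \<and> size (\<Sum>\<^sub># \<T>) \<le> m * order G"
proof (induction m arbitrary: S)
  case 0
  show ?case by (rule exI[of _ "{#}"]) (simp add: nontrivial_zero_sums_def)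
next
  case (Suc m)
  obtain T where T: "T \<subseteq># S" "T \<noteq> {#}" "zero_sum G T" "size T \<le> order G"
    using short_zero_sum_exists[OF fin Suc.prems(1)] Suc.prems(2) by auto
  have "seq_over G (S - T)" using Suc.prems(1) by (rule seq_over_mono[rotated]) simp
  moreover have "m * order G \<le> size (S - T)"
    using Suc.prems(2) T by (simp add: size_Diff_submset)
  ultimately obtain \<T> where \<T>: "nontrivial_zero_sums G m \<T>" "\<Sum>\<^sub># \<T> \<subseteq># S - T"
      "size (\<Sum>\<^sub># \<T>) \<le> m * order G"
    using Suc.IH by blast
  have "T + \<Sum>\<^sub># \<T> \<subseteq># S"
    using \<T>(2) T(1) by (metis subset_mset.le_diff_conv2 add.commute)
  then show ?case
    using \<T> T by (intro exI[of _ "add_mset T \<T>"]) (auto simp: nontrivial_zero_sums_def)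
qed

section \<open>Sequences of maximal length without short zero-sum subsequences\<close>

lemma M_set_no_short_zero_sum:
  assumes fin: "finite (carrier G)" and "k \<ge> 1" and S: "S \<in> M_set G k"
    and size: "size S = k * order G"
    and T: "T \<subseteq># S" "T \<noteq> {#}" "zero_sum G T"
  shows "order G \<le> size T"
proof (rule ccontr)
  assume short: "\<not> order G \<le> size T"
  have zS: "zero_sum G S" using S by (simp add: M_set_def)
  obtain m where k: "k = Suc m" using \<open>k \<ge> 1\<close> by (cases k) auto
  have "seq_over G (S - T)"
    using zS by (intro seq_over_mono[of "S - T" S]) (auto simp: zero_sum_def)
  \<comment> \<open>The inequality is strict because \<open>T\<close> has fewer than
    \<open>order G\<close> terms; this makes the rest \<open>R\<close> nonempty below.\<close>
  moreover have szd: "size (S - T) > m * order G"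
    using short T(1) size k size_mset_mono[OF T(1)] by (simp add: size_Diff_submset)
  ultimately obtain \<T> where \<T>: "nontrivial_zero_sums G m \<T>" "\<Sum>\<^sub># \<T> \<subseteq># S - T"
      "size (\<Sum>\<^sub># \<T>) \<le> m * order G"
    using disjoint_zero_sums_exist[OF fin, of "S - T" m] by auto
  define R where "R = S - T - \<Sum>\<^sub># \<T>"
  have S_eq: "S = \<Sum>\<^sub># (add_mset T \<T>) + R"
    unfolding R_def using \<T>(2) T(1)
    by (metis add.assoc subset_mset.add_diff_inverse sum_mset.add_mset)
  have "zero_sum G (\<Sum>\<^sub># (add_mset T \<T>))"
    using \<T>(1) T(3) by (intro zero_sum_Sum_mset) (auto simp: nontrivial_zero_sums_def)
  \<comment> \<open>The rest is zero-sum because both \<open>S\<close> and the extracted parts are,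
    so it can serve as part number \<open>k + 1\<close>.\<close>
  then have "zero_sum G R"
    using zero_sum_cancel_left zS S_eq by metis
  moreover have "size R > 0"
    unfolding R_def size_Diff_submset[OF \<T>(2)] using szd \<T>(3) by linarith
  ultimately have "nontrivial_zero_sums G (k + 1) (add_mset R (add_mset T \<T>))"
    using \<T>(1) T k by (auto simp: nontrivial_zero_sums_def)
  moreover have "\<Sum>\<^sub># (add_mset R (add_mset T \<T>)) = S"
    using S_eq by (simp add: ac_simps)
  ultimately show False using S by (auto simp: M_set_def)
qed

lemma eq_if_no_short_zero_sum:
  assumes fin: "finite (carrier G)" and S: "seq_over G S" and size: "order G \<le> size S"
    and no_short: "\<And>T. T \<subseteq># S \<Longrightarrow> T \<noteq> {#} \<Longrightarrow> zero_sum G T \<Longrightarrow> order G \<le> size T"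
    and gh: "g \<in># S" "h \<in># S"
  shows "g = h"
proof (rule ccontr)
  assume "g \<noteq> h"
  then have "h \<in># S - {#g#}" using gh by (simp add: in_diff_count)
  then obtain R where R: "S = add_mset g (add_mset h R)"
    using gh by (metis insert_DiffM)
  obtain ys where ys: "mset ys = R" by (metis ex_mset)
  \<comment> \<open>With \<open>g\<close> and \<open>h\<close> in front, the prefix of length 1 is
    \<open>g\<close> alone and every longer prefix contains both.\<close>
  define xs where "xs = g # h # ys"
  have xs: "mset xs = S" using R ys by (simp add: xs_def)
  have len: "order G \<le> length xs" using size xs by auto
  have set: "set xs \<subseteq> carrier G" using S xs by (auto simp: seq_over_def)
  have gc: "g \<in> carrier G" and hc: "h \<in> carrier G" using S gh by (auto simp: seq_over_def)
  let ?f = "\<lambda>i. seq_sum G (mset (take i xs))"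
  \<comment> \<open>The block between two such positions has \<open>j - i < order G\<close> terms,
    so it cannot be zero-sum.\<close>
  have inj: "?f i \<noteq> ?f j" if "i < j" "j < order G" for i j
  proof
    assume "?f i = ?f j"
    then have "zero_sum G (mset (drop i (take j xs)))"
      using zero_sum_infix[OF set] that by simp
    moreover have "mset (drop i (take j xs)) \<noteq> {#}" using that len by simp
    ultimately have "order G \<le> size (mset (drop i (take j xs)))"
      using no_short mset_infix_subset xs by metis
    then show False using that by simp
  qed
  have "inj_on ?f {..<order G}"
    by (rule linorder_inj_onI) (use inj in auto)
  moreover have "?f ` {..<order G} \<subseteq> carrier G"
    using set by (auto intro!: seq_sum_closed simp: seq_over_def dest!: in_set_takeD)
  ultimately have "?f ` {..<order G} = carrier G"
    using fin by (intro card_subset_eq) (simp_all add: card_image order_def)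
  then obtain i where i: "i < order G" "h = ?f i"
    using hc by blast
  have single: "seq_sum G {#x#} = x" if "x \<in> carrier G" for x
    using seq_sum_replicate[OF that, of 1] that by simp
  \<comment> \<open>If \<open>h\<close> is the empty product, \<open>{#h#}\<close> is a short
    zero-sum sequence; if it is the prefix \<open>g\<close>, then \<open>h = g\<close>; if it is a
    longer prefix, cancelling \<open>h\<close> leaves a zero-sum sequence of \<open>i - 1\<close>
    terms, which is again too short.\<close>
  consider "i = 0" | "i = 1" | j where "i = Suc (Suc j)"
    by (metis One_nat_def old.nat.exhaust)
  then show False
  proof cases
    case 1
    then have "zero_sum G {#h#}"
      using i hc single[OF hc]
      by (simp add: zero_sum_def seq_over_def seq_sum_empty[OF comm_group_axioms])
    moreover have "{#h#} \<subseteq># S" using gh by simp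
    \<comment> \<open>A single term counts as short only if the group is nontrivial, which the
      distinct elements \<open>g\<close> and \<open>h\<close> ensure.\<close>
    moreover have "order G > 1"
    proof -
      have "card {g, h} \<le> order G"
        unfolding order_def using fin gc hc by (intro card_mono) auto
      then show ?thesis using \<open>g \<noteq> h\<close> by simp
    qed
    ultimately show False using no_short[of "{#h#}"] by simp
  next
    case 2
    then show False using i \<open>g \<noteq> h\<close> single[OF gc] by (simp add: xs_def)
  next
    case 3
    define U where "U = add_mset g (mset (take j ys))"
    have tk: "mset (take i xs) = add_mset h U" using 3 by (simp add: xs_def U_def)
    have "mset (take j ys) \<subseteq># R"
      using mset_infix_subset[of 0 j ys] ys by simp
    then have US: "U \<subseteq># S"
      unfolding R U_def
      by (metis insert_subset_eq_iff add_mset_remove_trivial subset_mset.order_trans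
          union_single_eq_member diff_subset_eq_self mset_subset_eq_add_mset_cancel)
    then have U: "seq_over G U" using S seq_over_mono by blast
    have "h = h \<otimes> seq_sum G U"
      using i(2) tk seq_sum_add_mset[OF comm_group_axioms U hc] by simp
    then have "zero_sum G U"
      using U hc by (simp add: zero_sum_def seq_sum_closed)
    then have "order G \<le> size U"
      using no_short[OF US] by (simp add: U_def)
    then show False using i(1) 3 by (simp add: U_def)
  qed
qed

section \<open>Powers of a generator and the value of the Davenport constant\<close>

lemma zero_sum_replicate_size:
  assumes "g \<in> carrier G" "ord g = order G" "T \<noteq> {#}" "zero_sum G T" "T \<subseteq># replicate_mset m g"
  shows "order G \<le> size T"
proof -
  obtain l where l: "T = replicate_mset l g"
    using assms(5) by (metis msubseteq_replicate_msetE)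
  then have "g [^] l = \<one>"
    using assms(1,4) seq_sum_replicate by (simp add: zero_sum_def)
  then have "order G dvd l"
    using assms(1,2) pow_eq_id by metis
  then show ?thesis
    using l assms(3) by (auto intro: dvd_imp_le)
qed

text \<open>Each of the \<open>j\<close> parts uses up at least \<open>order G\<close> copies of
  \<open>g\<close>. This count yields both the lower bound for \<open>Davenport\<close> and the
  impossibility of \<open>k + 1\<close> parts in the theorem.\<close>

lemma nontrivial_zero_sums_replicate_size:
  assumes g: "g \<in> carrier G" "ord g = order G" and \<T>: "nontrivial_zero_sums G j \<T>"
    and sub: "\<Sum>\<^sub># \<T> \<subseteq># replicate_mset m g"
  shows "j * order G \<le> m"
proof -
  have "order G \<le> size T" if "T \<in># \<T>" for T
  proof (rule zero_sum_replicate_size[OF g])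
    show "T \<noteq> {#}" "zero_sum G T" using \<T> that by (auto simp: nontrivial_zero_sums_def)
    have "T \<subseteq># \<Sum>\<^sub># \<T>" using that by (auto dest!: multi_member_split)
    then show "T \<subseteq># replicate_mset m g" using sub by (rule subset_mset.order_trans)
  qed
  then have "size \<T> * order G \<le> size (\<Sum>\<^sub># \<T>)"
    by (induction \<T>) (simp_all add: add_mono)
  also have "\<dots> \<le> m" using size_mset_mono[OF sub] by simp
  finally show ?thesis using \<T> by (simp add: nontrivial_zero_sums_def)
qed

lemma Davenport_cyclic:
  assumes fin: "finite (carrier G)" and g: "g \<in> carrier G" "ord g = order G"
  shows "Davenport G k = k * order G"
  unfolding Davenport_def
proof (rule Least_equality)
  show "\<forall>S. seq_over G S \<and> k * order G \<le> size S \<longrightarrow>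
      (\<exists>\<T>. nontrivial_zero_sums G k \<T> \<and> \<Sum>\<^sub># \<T> \<subseteq># S)"
    using disjoint_zero_sums_exist[OF fin] by blast
next
  fix l
  assume l: "\<forall>S. seq_over G S \<and> l \<le> size S \<longrightarrow>
      (\<exists>\<T>. nontrivial_zero_sums G k \<T> \<and> \<Sum>\<^sub># \<T> \<subseteq># S)"
  \<comment> \<open>An admissible \<open>l\<close> is tested on the sequence of exactly
    \<open>l\<close> copies of the generator.\<close>
  have "seq_over G (replicate_mset l g)"
    using g by (simp add: seq_over_def)
  then obtain \<T> where "nontrivial_zero_sums G k \<T>" "\<Sum>\<^sub># \<T> \<subseteq># replicate_mset l g"
    using l by (metis size_replicate_mset order_refl)
  then show "k * order G \<le> l"
    by (rule nontrivial_zero_sums_replicate_size[OF g])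
qed

end

section \<open>The equivalence for cyclic groups\<close>

theorem theorem3p2:
  fixes G :: "('a, 'b) monoid_scheme" and k :: nat and S :: "'a multiset"
  assumes "group G" and "finite (carrier G)" and "cyclic_group G"
    and "k \<ge> 1"
    and "zero_sum G S" and "size S = Davenport G k"
  shows "S \<in> M_set G k \<longleftrightarrow>
    (\<exists>g\<in>carrier G. group.ord G g = order G \<and> S = replicate_mset (k * order G) g)"
proof -
  interpret group G by fact
  interpret comm_group G
    using assms(3) cyclic_imp_abelian_group by blast
  note fin = assms(2)
  have n: "order G > 0" using fin order_gt_0_iff_finite by simp
  obtain x where x: "x \<in> carrier G" "ord x = order G"
    using assms(3) cyclic_order_is_ord by (metis cyclic_group_def)
  have size: "size S = k * order G"
    using assms(6) Davenport_cyclic[OF fin x] by simp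
  have S: "seq_over G S" using assms(5) by (simp add: zero_sum_def)
  show ?thesis
  proof
    assume M: "S \<in> M_set G k"
    note no_short = M_set_no_short_zero_sum[OF fin assms(4) M size]
    have "order G \<le> size S" using size assms(4) by simp
    note all_eq = eq_if_no_short_zero_sum[OF fin S this no_short]
    have "S \<noteq> {#}" using size n assms(4) by auto
    then obtain g where gS: "g \<in># S" by blast
    then have g: "g \<in> carrier G" using S by (auto simp: seq_over_def)
    have "set_mset S \<subseteq> {g}" using all_eq gS by blast
    then have S_eq: "S = replicate_mset (k * order G) g"
      using size by (metis set_mset_subset_singletonD)
    have pos: "0 < ord g" using ord_ge_1[OF fin g] by simp
    have le: "ord g \<le> order G" using ord_dvd_group_order[OF g] n by (rule dvd_imp_le)
    \<comment> \<open>The sequence of \<open>ord g\<close> copies of \<open>g\<close> is itself a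
      zero-sum subsequence of \<open>S\<close>; since it cannot be short, \<open>g\<close> generates
      the group.\<close>
    have "order G \<le> size (replicate_mset (ord g) g)"
    proof (rule no_short)
      have "ord g \<le> k * order G" using le assms(4) n by (metis mult_le_mono1 nat_mult_1 order_trans)
      then show "replicate_mset (ord g) g \<subseteq># S"
        by (simp add: S_eq subseteq_mset_def)
      show "replicate_mset (ord g) g \<noteq> {#}" using pos by simp
      show "zero_sum G (replicate_mset (ord g) g)"
        using g by (simp add: zero_sum_def seq_over_def seq_sum_replicate)
    qed
    then have "ord g = order G" using le by simp
    then show "\<exists>g\<in>carrier G. ord g = order G \<and> S = replicate_mset (k * order G) g"
      using g S_eq by blast
  next
    assume "\<exists>g\<in>carrier G. ord g = order G \<and> S = replicate_mset (k * order G) g"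
    then obtain g where g: "g \<in> carrier G" "ord g = order G"
      and S_eq: "S = replicate_mset (k * order G) g" by blast
    have "\<not> (\<exists>\<T>. nontrivial_zero_sums G (k + 1) \<T> \<and> \<Sum>\<^sub># \<T> = S)"
    proof
      assume "\<exists>\<T>. nontrivial_zero_sums G (k + 1) \<T> \<and> \<Sum>\<^sub># \<T> = S"
      then have "(k + 1) * order G \<le> k * order G"
        using nontrivial_zero_sums_replicate_size[OF g] S_eq by (metis subset_mset.order_refl)
      then show False using n by simp
    qed
    then show "S \<in> M_set G k" using assms(5) by (simp add: M_set_def)
  qed
qed

end
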